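(* The four families $(cS_n)$, $(gS_n)$, $(bS_n)$, $(tS_n)$ are rare, i.e. for each of them $\lim_{n\to\infty}|A_n|/n!=0$.
   Context: Permutations act on $[n]$; products composed right to left. (c) $\pi\in cS_n$ if its disjoint cycle decomposition contains at most one cycle of length $\ge2$. (g) $\pi\in gS_n$ if the cyclic subgroup generated by $\pi$ is a simple group (the identity counts). (b) With $\tau_i=(i,i+1)$, $D(k,j)=\tau_k\tau_{k-1}\cdots\tau_j$ ($1\le j\le k\le n-1$), every $\pi\ne\mathrm{Id}$ has a unique expression $\pi=D(k_1,j_1)\cdots D(k_s,j_s)$ with $1\le k_1<\dots<k_s\le n-1$, $j_a\le k_a$, of length equal to the Coxeter length of $\pi$; $\pi\in bS_n$ if $\pi=\mathrm{Id}$ or each $\tau_i$ occurs at most once in this word. (t) Write each cycle of $\pi$ (fixed points included) starting with its largest element, order cycles by increasing largest element, erase parentheses to get a word $w$. Define $T(\emptyset)=\emptyset$, and for $w=usv$ with $s$ the smallest letter, $T(w)$ has root $s$, left subtree $T(u)$, right subtree $T(v)$. $\pi\in tS_n$ if every vertex of $T(w)$ has degree $1$ or $2$ (the one-vertex tree counts). A family $(A_n)$, $A_n\subseteq\Sigma_n$, is rare if $|A_n|/|\Sigma_n|\to0$. *)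

theory Defs
  imports
    Complex_Main
    "HOL-Algebra.SimpleGroups"
    "HOL-Algebra.Elementary_Groups"
    "HOL-Algebra.Sym_Groups"
    "HOL-Library.Tree"
begin

abbreviation Sym :: "nat \<Rightarrow> (nat \<Rightarrow> nat) set" where
  "Sym n \<equiv> carrier (sym_group n)"

definition rare :: "(nat \<Rightarrow> (nat \<Rightarrow> nat) set) \<Rightarrow> bool" where
  "rare A \<longleftrightarrow> (\<forall>n. A n \<subseteq> Sym n) \<and>
     (\<lambda>n. real (card (A n)) / real (card (Sym n))) \<longlonglongrightarrow> 0"

text \<open>
  The disjoint cycle decomposition (fixed points included) in standard form. The list
  \<open>support p m\<close> is \<open>[m, p m, p (p m), \<dots>]\<close>; each cycle is listed once, from its
  largest element, and the cycles come in the order of increasing largest elements.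
\<close>

definition cycles :: "nat \<Rightarrow> (nat \<Rightarrow> nat) \<Rightarrow> nat list list" where
  "cycles n p = map (support p) (filter (\<lambda>m. \<forall>x\<in>set (support p m). x \<le> m) [1..<Suc n])"

definition cS :: "nat \<Rightarrow> (nat \<Rightarrow> nat) set" where
  "cS n = {p \<in> Sym n. length (filter (\<lambda>c. length c \<ge> 2) (cycles n p)) \<le> 1}"

text \<open>
  The locale \<open>simple_group\<close> excludes the trivial group, so the identity is added by hand.
\<close>

definition gS :: "nat \<Rightarrow> (nat \<Rightarrow> nat) set" where
  "gS n = {p \<in> Sym n. p = id \<or> simple_group (subgroup_generated (sym_group n) {p})}"

text \<open>
  A word is a list of indices of adjacent transpositions; the word \<open>[i, j, \<dots>]\<close> stands for
  \<open>\<tau>\<^sub>i \<circ> \<tau>\<^sub>j \<circ> \<dots>\<close>, the rightmost letter acting first.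
\<close>

definition word_perm :: "nat list \<Rightarrow> nat \<Rightarrow> nat" where
  "word_perm w = foldr (\<lambda>i f. transpose i (Suc i) \<circ> f) w id"

definition D_word :: "nat \<Rightarrow> nat \<Rightarrow> nat list" where
  "D_word k j = rev [j..<Suc k]"

text \<open>The list \<open>[(k\<^sub>1, j\<^sub>1), \<dots>, (k\<^sub>s, j\<^sub>s)]\<close> encodes \<open>D(k\<^sub>1, j\<^sub>1) \<cdots> D(k\<^sub>s, j\<^sub>s)\<close>.\<close>

definition D_product_word :: "(nat \<times> nat) list \<Rightarrow> nat list" where
  "D_product_word e = concat (map (\<lambda>(k, j). D_word k j) e)"

definition D_admissible :: "nat \<Rightarrow> (nat \<times> nat) list \<Rightarrow> bool" where
  "D_admissible n e \<longleftrightarrow>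
     (\<forall>(k, j)\<in>set e. 1 \<le> j \<and> j \<le> k \<and> k < n) \<and> sorted_wrt (<) (map fst e)"

text \<open>
  Well defined by \<open>D_expression_unique\<close> below, where the empty list is the expression of the
  identity.
\<close>

definition normal_word :: "nat \<Rightarrow> (nat \<Rightarrow> nat) \<Rightarrow> nat list" where
  "normal_word n p =
     D_product_word (THE e. D_admissible n e \<and> word_perm (D_product_word e) = p)"

definition bS :: "nat \<Rightarrow> (nat \<Rightarrow> nat) set" where
  "bS n = {p \<in> Sym n. p = id \<or> distinct (normal_word n p)}"

function dec_tree :: "nat list \<Rightarrow> nat tree" where
  "dec_tree [] = Leaf"
| "w \<noteq> [] \<Longrightarrow> dec_tree w =
     (let s = Min (set w) in
      Node (dec_tree (takeWhile (\<lambda>x. x \<noteq> s) w)) s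
           (dec_tree (tl (dropWhile (\<lambda>x. x \<noteq> s) w))))"
  by auto

lemma dropWhile_Min_nonempty:
  assumes "w \<noteq> []"
  shows "dropWhile (\<lambda>x. x \<noteq> Min (set w)) w \<noteq> []"
proof -
  have "Min (set w) \<in> set w" using assms by simp
  then show ?thesis unfolding dropWhile_eq_Nil_conv by blast
qed

termination dec_tree
proof (relation "measure length", goal_cases)
  case (2 w s)
  have "length (takeWhile (\<lambda>x. x \<noteq> s) w) + length (dropWhile (\<lambda>x. x \<noteq> s) w) = length w"
    by (metis length_append takeWhile_dropWhile_id)
  moreover have "dropWhile (\<lambda>x. x \<noteq> s) w \<noteq> []"
    using 2 dropWhile_Min_nonempty by simp
  ultimately have "length (takeWhile (\<lambda>x. x \<noteq> s) w) < length w"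
    by (metis add_diff_cancel_right' diff_less length_greater_0_conv 2(1))
  then show ?case by simp
next
  case (3 w s)
  have "length (tl (dropWhile (\<lambda>x. x \<noteq> s) w)) < length w"
    using length_dropWhile_le[of "\<lambda>x. x \<noteq> s" w] dropWhile_Min_nonempty[OF 3(1)] 3(1)
    unfolding 3(2) length_tl by (meson diff_less length_greater_0_conv less_le_trans zero_less_one)
  then show ?case by simp
qed simp

text \<open>
  Edges of a binary tree as an undirected graph. Vertices are identified with their labels,
  which requires the labels to be distinct.
\<close>

fun root_labels :: "'a tree \<Rightarrow> 'a set" where
  "root_labels Leaf = {}"
| "root_labels (Node l s r) = {s}"

fun tree_edges :: "'a tree \<Rightarrow> 'a set set" where
  "tree_edges Leaf = {}"
| "tree_edges (Node l s r) =
     {{s, x} | x. x \<in> root_labels l \<union> root_labels r} \<union> tree_edges l \<union> tree_edges r"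

definition tree_degree :: "'a tree \<Rightarrow> 'a \<Rightarrow> nat" where
  "tree_degree t v = card {e \<in> tree_edges t. v \<in> e}"

definition tS :: "nat \<Rightarrow> (nat \<Rightarrow> nat) set" where
  "tS n = {p \<in> Sym n. let t = dec_tree (concat (cycles n p)) in
     size t = 1 \<or> (\<forall>v\<in>set_tree t. tree_degree t v \<in> {1, 2})}"

lemma word_perm_Nil [simp]: "word_perm [] = id"
  by (simp add: word_perm_def)

lemma word_perm_Cons [simp]: "word_perm (i # w) = transpose i (Suc i) \<circ> word_perm w"
  by (simp add: word_perm_def fun_eq_iff)

lemma word_perm_append: "word_perm (u @ v) = word_perm u \<circ> word_perm v"
  by (induction u) (simp_all add: comp_assoc)

lemma word_perm_permutes:
  assumes "\<forall>i\<in>set w. i \<in> A \<and> Suc i \<in> A"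
  shows "word_perm w permutes A"
  using assms
proof (induction w)
  case Nil
  then show ?case by (simp only: word_perm_Nil permutes_id)
next
  case (Cons i w)
  have t: "transpose i (Suc i) permutes A" using Cons.prems by (intro permutes_swap_id) auto
  have "word_perm w permutes A" using Cons by simp
  from permutes_compose[OF this t] show ?case by (simp only: word_perm_Cons)
qed

lemma word_perm_D_word: "j \<le> k \<Longrightarrow> word_perm (D_word k j) j = Suc k"
proof (induction k)
  case 0
  then show ?case by (simp add: D_word_def)
next
  case (Suc k)
  show ?case
  proof (cases "j \<le> k")
    case True
    then have "D_word (Suc k) j = [Suc k] @ D_word k j" by (simp add: D_word_def)
    then show ?thesis using Suc.IH True
      by (simp only: word_perm_append comp_apply) simp
  next
    case False
    then have "j = Suc k" using Suc.prems by simp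
    then show ?thesis by (simp add: D_word_def)
  qed
qed

lemma D_product_word_snoc:
  "word_perm (D_product_word (e @ [(k, j)])) = word_perm (D_product_word e) \<circ> word_perm (D_word k j)"
  by (simp add: D_product_word_def word_perm_append)

lemma D_admissible_permutes:
  assumes "D_admissible n e"
  shows "word_perm (D_product_word e) permutes {1..n}"
  using assms
  by (intro word_perm_permutes)
     (fastforce simp: D_product_word_def D_word_def D_admissible_def)

lemma D_admissible_Suc_iff:
  "D_admissible (Suc n) e \<longleftrightarrow>
     D_admissible n e \<or> (\<exists>e' j. e = e' @ [(n, j)] \<and> D_admissible n e' \<and> 1 \<le> j \<and> j \<le> n)"
proof (cases e rule: rev_cases)
  case Nil
  then show ?thesis by (simp add: D_admissible_def)
next
  case (snoc e' x)
  obtain k j where "x = (k, j)" by force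
  with snoc show ?thesis
    by (fastforce simp: D_admissible_def sorted_wrt_append)
qed

lemma D_expression_unique:
  assumes "p \<in> Sym n"
  shows "\<exists>!e. D_admissible n e \<and> word_perm (D_product_word e) = p"
proof -
  have "p permutes {1..n}" using assms by (simp add: sym_group_carrier)
  then show ?thesis
  proof (induction n arbitrary: p)
    case 0
    then have "p = id" by simp
    have adm: "D_admissible 0 e \<longleftrightarrow> e = []" for e
      by (cases e) (auto simp: D_admissible_def)
    have "word_perm (D_product_word []) = p"
      unfolding \<open>p = id\<close> by (simp add: D_product_word_def fun_eq_iff)
    then show ?case unfolding adm by blast
  next
    case (Suc n)
    have inj: "inj p" using Suc.prems permutes_inj by blast
    have old: "p (Suc n) = Suc n"
      if "D_admissible n e" "word_perm (D_product_word e) = p" for e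
      using permutes_not_in[OF D_admissible_permutes[OF that(1)], of "Suc n"] that(2) by simp
    have new: "p j = Suc n"
      if "D_admissible n e" "j \<le> n" "word_perm (D_product_word (e @ [(n, j)])) = p" for e j
      using permutes_not_in[OF D_admissible_permutes[OF that(1)], of "Suc n"] that(3)
        word_perm_D_word[OF that(2)]
      by (auto simp: D_product_word_snoc)
    show ?case
    proof (cases "p (Suc n) = Suc n")
      case True
      have "p permutes {1..n}"
        using True by (intro permutes_superset[OF Suc.prems]) (auto simp: le_Suc_eq)
      from Suc.IH[OF this] obtain e where
        e: "D_admissible n e" "word_perm (D_product_word e) = p"
        and u: "\<And>f. D_admissible n f \<Longrightarrow> word_perm (D_product_word f) = p \<Longrightarrow> f = e" by blast
      show ?thesis
      proof (rule ex1I[of _ e])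
        fix f assume f: "D_admissible (Suc n) f \<and> word_perm (D_product_word f) = p"
        have "D_admissible n f"
        proof (rule ccontr)
          assume "\<not> D_admissible n f"
          then obtain f' j where "f = f' @ [(n, j)]" "D_admissible n f'" "j \<le> n"
            using f by (auto simp: D_admissible_Suc_iff)
          then have "p j = Suc n" using new f by blast
          then have "j = Suc n" using True inj by (metis injD)
          then show False using \<open>j \<le> n\<close> by simp
        qed
        then show "f = e" using u f by blast
      qed (use e in \<open>auto simp: D_admissible_Suc_iff\<close>)
    next
      case False
      have "Suc n \<in> p ` {1..Suc n}" using permutes_image[OF Suc.prems] by simp
      then obtain j where j: "p j = Suc n" "1 \<le> j" "j \<le> Suc n" by fastforce
      moreover have "j \<noteq> Suc n" using False j(1) by blast
      ultimately have jn: "j \<le> n" by simp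
      define d where "d = word_perm (D_word n j)"
      have d: "d permutes {1..Suc n}"
        unfolding d_def using j jn by (intro word_perm_permutes) (auto simp: D_word_def)
      have dj: "d j = Suc n" using word_perm_D_word jn by (simp add: d_def)
      define q where "q = p \<circ> inv' d"
      have q: "q permutes {1..Suc n}" unfolding q_def
        by (intro permutes_compose permutes_inv d Suc.prems)
      have qn: "q (Suc n) = Suc n"
        using j dj permutes_inverses(2)[OF d, of j] by (simp add: q_def)
      have "q permutes {1..n}"
        using qn by (intro permutes_superset[OF q]) (auto simp: le_Suc_eq)
      from Suc.IH[OF this] obtain e where
        e: "D_admissible n e" "word_perm (D_product_word e) = q"
        and u: "\<And>f. D_admissible n f \<Longrightarrow> word_perm (D_product_word f) = q \<Longrightarrow> f = e" by blast
      have qd: "q \<circ> d = p" using permutes_inv_o(2)[OF d] by (simp add: q_def comp_assoc)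
      show ?thesis
      proof (rule ex1I[of _ "e @ [(n, j)]"])
        show "D_admissible (Suc n) (e @ [(n, j)]) \<and> word_perm (D_product_word (e @ [(n, j)])) = p"
          using e j jn qd by (auto simp: D_admissible_Suc_iff D_product_word_snoc d_def)
      next
        fix f assume f: "D_admissible (Suc n) f \<and> word_perm (D_product_word f) = p"
        then have "\<not> D_admissible n f" using old False by blast
        then obtain f' i where f': "f = f' @ [(n, i)]" "D_admissible n f'" "i \<le> n"
          using f by (auto simp: D_admissible_Suc_iff)
        then have "p i = Suc n" using new f by blast
        then have i: "i = j" using j inj by (metis injD)
        have "word_perm (D_product_word f') \<circ> d = p"
          using f f' i by (simp add: D_product_word_snoc d_def)
        then have "word_perm (D_product_word f') = q"
          using permutes_inv_o(1)[OF d] unfolding q_def by (metis comp_assoc comp_id)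
        then show "f = e @ [(n, j)]" using u f' i by simp
      qed
    qed
  qed
qed

end

theory Submission
  imports Defs "HOL-Algebra.Multiplicative_Group"
begin

text \<open>
  A permutation is determined by the cycle through a given point \<open>x\<close> and by what remains after
  that cycle is removed. For \<open>cS\<close> either \<open>n\<close> is fixed or nothing remains, so there
  are at most \<open>(n - 1)! + e (n - 1)!\<close> members. A cyclic group is simple only if its order is a
  prime \<open>r\<close>, so \<open>gS\<close> consists of permutations whose cycles have length \<open>1\<close> or
  \<open>r\<close>; splitting off the cycle of \<open>x\<close> gives a recursion for their number.
  Inserting the trivial bound \<open>k!\<close> into it gives \<open>2 (n - 1)!\<close>, and inserting the result once
  more gives a bound whose sum over all \<open>r \<le> n\<close> is \<open>(n - 1)!\<close> times a harmonic
  sum, hence \<open>o(n!)\<close>.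

  The other two families grow exponentially. In a normal word without repeated letters the
  \<open>k\<^sub>a\<close> and the \<open>j\<^sub>a\<close> both increase, so the word is determined by two subsets
  of \<open>{1..n}\<close>. In a tree with all degrees at most \<open>2\<close> only the root can have two
  children, so its word is a smallest letter between two unimodal words and is determined
  by four subsets.
\<close>

subsection \<open>Removing a cycle\<close>

definition off_orbit :: "('a \<Rightarrow> 'a) \<Rightarrow> 'a \<Rightarrow> 'a \<Rightarrow> 'a" where
  "off_orbit p x = (\<lambda>y. if y \<in> set (support p x) then y else p y)"

lemma mem_support:
  assumes "permutation p"
  shows "x \<in> set (support p x)"
  using least_power_of_permutation(2)[OF assms, of x] by force

lemma support_eq_Cons:
  assumes "permutation p"
  shows "support p x = x # tl (support p x)"
  using least_power_of_permutation(2)[OF assms, of x]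
  by (simp add: upt_conv_Cons)

lemma support_eq_if_mem:
  assumes "permutation p" "y \<in> set (support p x)"
  shows "set (support p y) = set (support p x)"
  using disjoint_support[OF assms(1)] disjoint_support'[OF assms(1), of y x] assms(2)
  unfolding disjoint_def by blast

lemma support_subset:
  assumes "p permutes S" "x \<in> S"
  shows "set (support p x) \<subseteq> S"
  using permutes_in_image[OF permutes_funpow[OF assms(1)]] assms(2) by auto

lemma off_orbit_permutes:
  assumes "p permutes S" "finite S"
  shows "off_orbit p x permutes (S - set (support p x))"
proof -
  have "off_orbit p x = (\<lambda>y. if y \<in> S - set (support p x) then p y else y)"
    using permutes_not_in[OF assms(1)] by (auto simp: off_orbit_def fun_eq_iff)
  then show ?thesis using semidecomposition[OF assms, of x] by simp
qed

text \<open>The list \<open>support p x\<close> fixes \<open>p\<close> on the cycle, each entry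
  being sent cyclically to the next, and \<open>off_orbit p x\<close> fixes \<open>p\<close>
  elsewhere. This turns the removal of a cycle into an upper bound for cardinalities.\<close>

lemma off_orbit_inject:
  assumes "permutation p" "permutation q"
    and "support p x = support q x" "off_orbit p x = off_orbit q x"
  shows "p = q"
proof
  fix y
  show "p y = q y"
  proof (cases "y \<in> set (support p x)")
    case True
    then show ?thesis
      using cycle_restrict[OF assms(1) True] cycle_restrict[OF assms(2), of y x] assms(3) by simp
  next
    case False
    then show ?thesis using assms(3) fun_cong[OF assms(4), of y] by (simp add: off_orbit_def)
  qed
qed

text \<open>Iterates of \<open>p\<close> never enter or leave the cycle of \<open>x\<close>. Through
  this the equation \<open>p ^^ r = id\<close> passes to the remainder.\<close>

lemma funpow_off_orbit:
  assumes "permutation p"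
  shows "(off_orbit p x ^^ n) y = (if y \<in> set (support p x) then y else (p ^^ n) y)"
proof (induction n)
  case (Suc n)
  have "(p ^^ n) y \<in> set (support p x) \<longleftrightarrow> y \<in> set (support p x)"
  proof -
    have "(p ^^ n) y \<in> set (support p y)" unfolding support_set[OF assms] by blast
    then show ?thesis
      using support_eq_if_mem[OF assms] mem_support[OF assms] by metis
  qed
  then show ?case using Suc by (simp add: off_orbit_def)
qed simp

section \<open>Counting lists without repetition\<close>

text \<open>The falling factorial is written as a quotient of factorials, so that its denominator
  cancels against later bounds containing \<open>fact (card A - k)\<close>.\<close>

lemma card_distinct_lists:
  assumes "finite A" "k \<le> card A"
  shows "real (card {xs. length xs = k \<and> distinct xs \<and> set xs \<subseteq> A}) =
    fact (card A) / fact (card A - k)"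
proof -
  have "\<Prod>{1..card A} = \<Prod>{1..card A - k} * \<Prod>{card A - k + 1..card A}"
    using prod.ub_add_nat[of 1 "card A - k" "\<lambda>i. i" k] assms(2) by simp
  then have "(fact (card A) :: nat) = fact (card A - k) * \<Prod>{card A - k + 1..card A}"
    by (simp add: fact_prod)
  then have "real (fact (card A)) = real (fact (card A - k)) * real (\<Prod>{card A - k + 1..card A})"
    by (metis of_nat_mult)
  then show ?thesis
    by (simp add: card_lists_distinct_length_eq[OF assms] field_simps)
qed

text \<open>Summation over the length gives \<open>fact (card A)\<close> times a partial sum of the
  series of \<open>exp 1\<close>, and \<open>exp 1\<close> is at most 3.\<close>

lemma card_all_distinct_lists_le:
  assumes "finite A"
  shows "real (card {xs. distinct xs \<and> set xs \<subseteq> A}) \<le> 3 * fact (card A)"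
proof -
  have "{xs. distinct xs \<and> set xs \<subseteq> A} =
    (\<Union>k\<in>{..card A}. {xs. length xs = k \<and> distinct xs \<and> set xs \<subseteq> A})"
    using card_mono[OF assms] by (auto simp: distinct_card[symmetric])
  then have "card {xs. distinct xs \<and> set xs \<subseteq> A} \<le>
    (\<Sum>k\<in>{..card A}. card {xs. length xs = k \<and> distinct xs \<and> set xs \<subseteq> A})"
    by (simp add: card_UN_le)
  then have "real (card {xs. distinct xs \<and> set xs \<subseteq> A}) \<le>
    (\<Sum>k\<in>{..card A}. real (card {xs. length xs = k \<and> distinct xs \<and> set xs \<subseteq> A}))"
    by (simp only: of_nat_sum[symmetric] of_nat_le_iff)
  also have "\<dots> = (\<Sum>k\<in>{..card A}. fact (card A) / fact (card A - k))"
    using assms by (intro sum.cong refl card_distinct_lists) auto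
  also have "\<dots> = fact (card A) * (\<Sum>k\<in>{..card A}. 1 / fact (card A - k))"
    by (simp add: sum_distrib_left)
  also have "(\<Sum>k\<in>{..card A}. 1 / fact (card A - k)) = (\<Sum>k\<in>{..card A}. 1 / fact k :: real)"
    by (rule sum.reindex_bij_witness[where i = "\<lambda>k. card A - k" and j = "\<lambda>k. card A - k"]) auto
  also have "\<dots> \<le> exp 1"
    using sum_le_suminf[OF summable_exp[of "1::real"], of "{..card A}"]
    by (simp add: exp_def divide_inverse)
  also have "\<dots> \<le> (3::real)" by (rule exp_le)
  finally show ?thesis by (simp add: mult.commute)
qed

subsection \<open>Permutations with one nontrivial cycle\<close>

lemma set_cycles:
  "set (cycles n p) = {support p m | m. m \<in> {1..n} \<and> (\<forall>y\<in>set (support p m). y \<le> m)}"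
  unfolding cycles_def by (auto simp del: upt_Suc)

text \<open>The witness is the largest element of the orbit of \<open>x\<close>, the representative
  from which \<open>cycles\<close> lists that orbit.\<close>

lemma cycle_max_exists:
  assumes "p permutes {1..n}" "x \<in> {1..n}"
  obtains m where "x \<in> set (support p m)" "support p m \<in> set (cycles n p)"
proof -
  have perm: "permutation p" using assms(1) permutation_permutes by blast
  define m where "m = Max (set (support p x))"
  have "set (support p x) \<noteq> {}" using mem_support[OF perm, of x] by (metis empty_iff)
  then have m: "m \<in> set (support p x)" unfolding m_def by (intro Max_in) auto
  have eq: "set (support p m) = set (support p x)" by (rule support_eq_if_mem[OF perm m])
  have "y \<le> m" if "y \<in> set (support p m)" for y
    using that[unfolded eq] unfolding m_def by (rule Max_ge[OF List.finite_set])
  moreover have "m \<in> {1..n}" using support_subset[OF assms] m by blast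
  ultimately have "support p m \<in> set (cycles n p)" unfolding set_cycles by blast
  then show thesis using that eq mem_support[OF perm, of x] by blast
qed

text \<open>The cycle of the moved point \<open>n\<close> is nontrivial; a moved point outside it
  would lie on a second listed cycle of length at least 2.\<close>

lemma cS_off_orbit:
  assumes "p \<in> cS n" "n \<ge> 1" "p n \<noteq> n"
  shows "off_orbit p n = id"
proof
  fix y
  have p: "p permutes {1..n}" using assms(1) by (simp add: cS_def sym_group_carrier)
  have perm: "permutation p" using p permutation_permutes by blast
  have long: "length (support p m) \<ge> 2" if "y \<in> set (support p m)" "p y \<noteq> y" for m y
  proof (rule ccontr)
    assume "\<not> length (support p m) \<ge> 2"
    then have "least_power p m = 1"
      using least_power_of_permutation(2)[OF perm, of m] by simp
    then have "p m = m" "y = m"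
      using least_power_of_permutation(1)[OF perm, of m] that(1) by simp_all
    then show False using that(2) by simp
  qed
  show "off_orbit p n y = id y"
  proof (rule ccontr)
    assume "off_orbit p n y \<noteq> id y"
    then have y: "y \<notin> set (support p n)" "p y \<noteq> y"
      by (auto simp: off_orbit_def split: if_splits)
    then have "y \<in> {1..n}" using permutes_not_in[OF p] by blast
    then obtain m where m: "y \<in> set (support p m)" "support p m \<in> set (cycles n p)"
      using cycle_max_exists[OF p] by blast
    \<comment> \<open>As the largest point of all, \<open>n\<close> is the representative of its own
      cycle.\<close>
    have "n \<in> {1..n}" using assms(2) by simp
    then have "set (support p n) \<subseteq> {1..n}" by (rule support_subset[OF p])
    then have "\<forall>y\<in>set (support p n). y \<le> n" by (meson atLeastAtMost_iff subsetD)
    with \<open>n \<in> {1..n}\<close> have n: "support p n \<in> set (cycles n p)" unfolding set_cycles by blast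
    let ?L = "filter (\<lambda>c. length c \<ge> 2) (cycles n p)"
    have "{support p m, support p n} \<subseteq> set ?L"
      using m n long[OF m(1) y(2)] long[OF mem_support[OF perm] assms(3)] by auto
    moreover have "support p m \<noteq> support p n" using m(1) y(1) by metis
    ultimately have "2 \<le> card (set ?L)"
      by (metis List.finite_set card_2_iff card_mono)
    also have "\<dots> \<le> length ?L" by (rule card_length)
    finally show False using assms(1) by (simp add: cS_def)
  qed
qed

text \<open>The members fixing \<open>n\<close> permute \<open>{1..n - 1}\<close>. Each other member
  is determined by the tail of its cycle through \<open>n\<close>, a list of distinct elements of
  \<open>{1..n - 1}\<close>.\<close>

lemma card_cS_le:
  assumes "n \<ge> 1"
  shows "real (card (cS n)) \<le> 4 * fact (n - 1)"
proof -
  let ?F = "{p. p permutes {1..n - 1}}"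
  let ?M = "{p \<in> cS n. p n \<noteq> n}"
  let ?L = "{xs. distinct xs \<and> set xs \<subseteq> {1..n - 1}}"
  have perm: "permutation p" if "p \<in> cS n" for p
    using that permutation_permutes by (auto simp: cS_def sym_group_carrier)
  have "cS n \<subseteq> ?F \<union> ?M"
  proof
    fix p assume p: "p \<in> cS n"
    have "p permutes {1..n}" using p by (simp add: cS_def sym_group_carrier)
    then have "p permutes {1..n - 1}" if "p n = n"
    proof (rule permutes_superset)
      fix x assume "x \<in> {1..n} - {1..n - 1}"
      then have "x = n" by auto
      then show "p x = x" using that by simp
    qed
    then show "p \<in> ?F \<union> ?M" using p by blast
  qed
  moreover have "finite ?F" by (simp add: finite_permutations)
  moreover have finL: "finite ?L"
    by (rule finite_subset[OF _ finite_subset_distinct[of "{1..n - 1}"]]) auto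
  moreover have inj: "inj_on (\<lambda>p. tl (support p n)) ?M"
  proof (rule inj_onI)
    fix p q assume pq: "p \<in> ?M" "q \<in> ?M" "tl (support p n) = tl (support q n)"
    then have "support p n = support q n"
      using support_eq_Cons[OF perm, of p n] support_eq_Cons[OF perm, of q n] by (metis mem_Collect_eq)
    moreover have "off_orbit p n = off_orbit q n" using pq assms by (simp add: cS_off_orbit)
    ultimately show "p = q"
      by (rule off_orbit_inject[OF perm perm, rotated 2]) (use pq in simp_all)
  qed
  moreover have sub: "(\<lambda>p. tl (support p n)) ` ?M \<subseteq> ?L"
  proof clarify
    have rest: "distinct xs \<and> set xs \<subseteq> {1..n - 1}"
      if "distinct (n # xs)" "set (n # xs) \<subseteq> {1..n}" for xs
    proof (intro conjI subsetI)
      fix x assume "x \<in> set xs"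
      then have "x \<noteq> n" "1 \<le> x" "x \<le> n" using that by auto
      then show "x \<in> {1..n - 1}" by auto
    qed (use that in simp)
    fix p assume p: "p \<in> cS n"
    have c: "support p n = n # tl (support p n)" by (rule support_eq_Cons[OF perm[OF p]])
    have d: "distinct (support p n)" by (rule cycle_of_permutation[OF perm[OF p]])
    have s: "set (support p n) \<subseteq> {1..n}"
      using p assms by (intro support_subset) (auto simp: cS_def sym_group_carrier)
    have "distinct (n # tl (support p n))" using c d by simp
    moreover have "set (n # tl (support p n)) \<subseteq> {1..n}" using c s by simp
    ultimately show "distinct (tl (support p n)) \<and> set (tl (support p n)) \<subseteq> {1..n - 1}"
      by (rule rest)
  qed
  ultimately have "card (cS n) \<le> card ?F + card ?M"
    by (meson card_Un_le card_mono finite_UnI inj_on_finite order_trans)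
  also have "\<dots> \<le> fact (n - 1) + card ?L"
    using card_inj_on_le[OF inj sub finL] card_permutations[of "{1..n - 1}" "n - 1"] by simp
  finally have "real (card (cS n)) \<le> real (fact (n - 1) + card ?L)"
    by (simp only: of_nat_le_iff)
  also have "\<dots> = fact (n - 1) + real (card ?L)" by simp
  also have "real (card ?L) \<le> 3 * fact (n - 1)"
    using card_all_distinct_lists_le[of "{1..n - 1}"] by simp
  finally show ?thesis by simp
qed

subsection \<open>Permutations of prime order\<close>

text \<open>For \<open>d\<close> dividing \<open>ord x\<close>, the powers of \<open>x [^] d\<close>
  form a subgroup of order \<open>ord x div d\<close>. It is normal because a cyclic group is
  abelian, so simplicity forces \<open>d\<close> to be 1 or \<open>ord x\<close>.\<close>

lemma (in group) simple_cyclic_ord_prime: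
  assumes "finite (carrier G)" "x \<in> carrier G" "simple_group (subgroup_generated G {x})"
  shows "prime (ord x)"
proof -
  let ?H = "subgroup_generated G {x}"
  interpret H: simple_group ?H by fact
  have ord: "ord x = order ?H" by (rule cyclic_order_is_ord[OF assms(2)])
  have "d = 1 \<or> d = ord x" if d: "d dvd ord x" for d
  proof -
    let ?y = "x [^] d"
    let ?K = "carrier (subgroup_generated G {?y})"
    have dpos: "d > 0" using d H.order_gt_one ord by (auto intro!: Nat.gr0I)
    have y: "?y \<in> carrier G" using assms(2) by simp
    have "?K \<subseteq> carrier ?H"
      unfolding carrier_subgroup_generated_by_singleton[OF y]
        carrier_subgroup_generated_by_singleton[OF assms(2)]
      using assms(2) by (auto simp: int_pow_pow simp flip: int_pow_int)
    then have "subgroup ?K ?H"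
      by (simp add: subgroup_subgroup_generated_iff subgroup_subgroup_generated)
    moreover have "comm_group ?H"
    proof (rule group.group_comm_groupI)
      fix a b assume "a \<in> carrier ?H" "b \<in> carrier ?H"
      then show "a \<otimes>\<^bsub>?H\<^esub> b = b \<otimes>\<^bsub>?H\<^esub> a"
        unfolding carrier_subgroup_generated_by_singleton[OF assms(2)]
        using assms(2) by (auto simp: int_pow_mult[symmetric] add.commute)
    qed (rule H.is_group)
    ultimately have "?K \<lhd> ?H"
      using comm_group.subgroup_imp_normal by blast
    then have "?K = carrier ?H \<or> ?K = {\<one>}"
      using H.no_real_normal_subgroup by force
    moreover have "card ?K = ord x div d"
    proof -
      have "card ?K = ord ?y" using cyclic_order_is_ord[OF y] by (simp add: order_def)
      also have "\<dots> = ord x div d"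
        using dpos d ord_pow_gen[OF assms(2), of d] by (simp add: gcd_nat.absorb2)
      finally show ?thesis .
    qed
    ultimately have "ord x div d = ord x \<or> ord x div d = 1"
      using ord by (auto simp: order_def)
    then show ?thesis
      using d dpos H.order_gt_one ord by (auto elim!: dvdE)
  qed
  then show ?thesis using H.order_gt_one ord by (auto simp: prime_nat_iff)
qed

section \<open>Permutations with trivial \<open>r\<close>-th power\<close>

lemma sym_group_pow: "p [^]\<^bsub>sym_group n\<^esub> (k::nat) = p ^^ k"
  by (induction k) (simp_all add: sym_group_mult sym_group_one funpow_Suc_right del: funpow.simps(2))

text \<open>For prime \<open>r\<close> these are the permutations whose cycles all have length 1 or
  \<open>r\<close>. The set \<open>S\<close> is arbitrary because removing a cycle from
  \<open>{1..n}\<close> need not leave an interval, and the remainder may be the identity.\<close>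

definition perm_roots :: "'a set \<Rightarrow> nat \<Rightarrow> ('a \<Rightarrow> 'a) set" where
  "perm_roots S r = {p. p permutes S \<and> p ^^ r = id}"

lemma finite_perm_roots: "finite S \<Longrightarrow> finite (perm_roots S r)"
  unfolding perm_roots_def by (rule finite_subset[OF _ finite_permutations]) auto

lemma card_perm_roots_le_fact:
  assumes "finite S"
  shows "card (perm_roots S r) \<le> fact (card S)"
  unfolding perm_roots_def card_permutations[OF refl assms, symmetric]
  by (rule card_mono) (auto simp: finite_permutations assms)

text \<open>The least power divides the prime \<open>r\<close> and is not 1 at a moved
  point.\<close>

lemma least_power_root:
  assumes "p ^^ r = id" "prime r" "p x \<noteq> x"
  shows "least_power p x = r"
proof -
  have "least_power p x dvd r" using assms(1) by (intro least_power_minimal) simp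
  moreover have "least_power p x \<noteq> 1"
    using least_powerI(1)[of r p x] assms prime_gt_0_nat[OF assms(2)] by auto
  ultimately show ?thesis using assms(2) by (auto simp: prime_nat_iff)
qed

text \<open>The first summand counts the \<open>p\<close> that fix \<open>x\<close>. Otherwise the
  cycle of \<open>x\<close> has length \<open>r\<close>, and \<open>p\<close> is determined by its
  tail \<open>ys\<close> together with a remainder satisfying the same equation on the other
  points.\<close>

lemma card_perm_roots_le:
  assumes "finite S" "x \<in> S" "prime r"
  shows "card (perm_roots S r) \<le> card (perm_roots (S - {x}) r) +
    (\<Sum>ys\<in>{ys. length ys = r - 1 \<and> distinct ys \<and> set ys \<subseteq> S - {x}}.
      card (perm_roots (S - insert x (set ys)) r))"
proof -
  let ?L = "{ys. length ys = r - 1 \<and> distinct ys \<and> set ys \<subseteq> S - {x}}"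
  let ?M = "{p \<in> perm_roots S r. p x \<noteq> x}"
  let ?\<phi> = "\<lambda>p. (tl (support p x), off_orbit p x)"
  let ?T = "SIGMA ys:?L. perm_roots (S - insert x (set ys)) r"
  have perm: "permutation p" if "p \<in> perm_roots S r" for p
    using that assms(1) permutation_permutes unfolding perm_roots_def by blast
  have finL: "finite ?L"
    by (rule finite_subset[OF _ finite_subset_distinct[of "S - {x}"]]) (use assms(1) in auto)
  then have finT: "finite ?T" using assms(1) by (auto intro!: finite_SigmaI finite_perm_roots)
  have inj: "inj_on ?\<phi> ?M"
  proof (rule inj_onI)
    fix p q assume pq: "p \<in> ?M" "q \<in> ?M" "?\<phi> p = ?\<phi> q"
    have "tl (support p x) = tl (support q x)" using pq(3) by (simp only: prod.inject)
    then have "support p x = support q x"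
      using support_eq_Cons[OF perm, of p x] support_eq_Cons[OF perm, of q x] pq(1,2)
      by (metis (no_types, lifting) mem_Collect_eq)
    moreover have "off_orbit p x = off_orbit q x" using pq(3) by (simp only: prod.inject)
    ultimately show "p = q"
      by (rule off_orbit_inject[OF perm perm, rotated 2]) (use pq in simp_all)
  qed
  have sub: "?\<phi> ` ?M \<subseteq> ?T"
  proof (rule image_subsetI)
    fix p assume p: "p \<in> ?M"
    then have pS: "p permutes S" and pr: "p ^^ r = id" and pp: "permutation p"
      using perm by (auto simp: perm_roots_def)
    obtain ys where ys: "support p x = x # ys" using support_eq_Cons[OF pp, of x] by metis
    have "least_power p x = r" by (rule least_power_root[OF pr assms(3)]) (use p in simp)
    then have len: "length ys = r - 1" using arg_cong[OF ys, of length] by simp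
    have "distinct (x # ys)" using cycle_of_permutation[OF pp, of x] ys by metis
    moreover have "set (x # ys) \<subseteq> S" using support_subset[OF pS assms(2)] ys by metis
    ultimately have yL: "ys \<in> ?L" using len by auto
    have "off_orbit p x permutes S - set (x # ys)"
      using off_orbit_permutes[OF pS assms(1), of x] ys by metis
    moreover have "off_orbit p x ^^ r = id"
      by (rule ext) (simp only: funpow_off_orbit[OF pp] pr id_apply if_cancel)
    ultimately have "off_orbit p x \<in> perm_roots (S - insert x (set ys)) r"
      by (simp add: perm_roots_def)
    moreover have "tl (support p x) = ys" using ys by (metis list.sel(3))
    ultimately show "?\<phi> p \<in> ?T" using yL by simp
  qed
  have "p permutes S - {x}" if "p permutes S" "p x = x" for p
    using that by (auto intro: permutes_superset)
  then have "perm_roots S r \<subseteq> perm_roots (S - {x}) r \<union> ?M"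
    by (auto simp: perm_roots_def)
  then have "card (perm_roots S r) \<le> card (perm_roots (S - {x}) r \<union> ?M)"
    using assms(1) by (intro card_mono) (auto simp: finite_perm_roots)
  also have "\<dots> \<le> card (perm_roots (S - {x}) r) + card ?M" by (rule card_Un_le)
  also have "card ?M \<le> card ?T" by (rule card_inj_on_le[OF inj sub finT])
  also have "card ?T = (\<Sum>ys\<in>?L. card (perm_roots (S - insert x (set ys)) r))"
    using finL assms(1) by (intro card_SigmaI) (auto simp: finite_perm_roots)
  finally show ?thesis by simp
qed

text \<open>The bound \<open>b\<close> stays abstract because the recursion is used twice, first
  with the factorial and then with the bound obtained from it. For \<open>r > Suc m\<close> there is
  no room for a cycle of length \<open>r\<close>.\<close>

lemma card_perm_roots_step:
  fixes b :: "nat \<Rightarrow> real"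
  assumes b: "\<And>T :: 'a set. finite T \<Longrightarrow> real (card (perm_roots T r)) \<le> b (card T)"
    and S: "finite (S :: 'a set)" "card S = Suc m" and r: "prime r"
  shows "real (card (perm_roots S r)) \<le>
    b m + (if r \<le> Suc m then fact m / fact (Suc m - r) * b (Suc m - r) else 0)"
proof -
  obtain x where x: "x \<in> S" using S(2) by fastforce
  let ?L = "{ys. length ys = r - 1 \<and> distinct ys \<and> set ys \<subseteq> S - {x}}"
  have cx: "card (S - {x}) = m" using S x by simp
  have card_rest: "card (S - insert x (set ys)) = Suc m - r" if "ys \<in> ?L" for ys
  proof -
    have "card (insert x (set ys)) = r"
      using that prime_gt_0_nat[OF r] by (subst card_insert_disjoint) (auto simp: distinct_card)
    moreover have "insert x (set ys) \<subseteq> S" using that x by auto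
    ultimately show ?thesis using S by (simp add: card_Diff_subset)
  qed
  have "real (card (perm_roots S r)) \<le> real (card (perm_roots (S - {x}) r) +
    (\<Sum>ys\<in>?L. card (perm_roots (S - insert x (set ys)) r)))"
    unfolding of_nat_le_iff by (rule card_perm_roots_le[OF S(1) x r])
  also have "\<dots> = real (card (perm_roots (S - {x}) r)) +
    (\<Sum>ys\<in>?L. real (card (perm_roots (S - insert x (set ys)) r)))" by simp
  also have "\<dots> \<le> b m + (\<Sum>ys\<in>?L. b (Suc m - r))"
    using b[of "S - {x}"] cx card_rest S(1)
    by (intro add_mono sum_mono) (auto intro!: order_trans[OF b])
  also have "(\<Sum>ys\<in>?L. b (Suc m - r)) =
    (if r \<le> Suc m then fact m / fact (Suc m - r) * b (Suc m - r) else 0)"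
  proof (cases "r \<le> Suc m")
    case True
    moreover have "m - (r - 1) = Suc m - r" using prime_gt_0_nat[OF r] by simp
    ultimately show ?thesis
      using card_distinct_lists[of "S - {x}" "r - 1"] S(1) cx by simp
  next
    case False
    have "?L = {}"
    proof safe
      fix ys assume "length ys = r - 1" "distinct ys" "set ys \<subseteq> S - {x}"
      then have "r - 1 \<le> m" using card_mono[of "S - {x}" "set ys"] S(1) cx
        by (simp add: distinct_card)
      then show "ys \<in> {}" using False by simp
    qed
    then show ?thesis unfolding \<open>?L = {}\<close> using False by simp
  qed
  finally show ?thesis by simp
qed

text \<open>The form \<open>4 / (n + 1)\<close> in place of \<open>2 / n\<close> also covers the empty set.\<close>

lemma card_perm_roots_bound:
  assumes "finite S" "prime r"
  shows "real (card (perm_roots S r)) \<le> 4 * fact (card S) / (real (card S) + 1)"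
proof (cases "card S")
  case 0
  then show ?thesis using card_perm_roots_le_fact[OF assms(1), of r] by simp
next
  case (Suc m)
  have "real (card (perm_roots S r)) \<le>
    fact m + (if r \<le> Suc m then fact m / fact (Suc m - r) * fact (Suc m - r) else 0)"
  proof (rule card_perm_roots_step[OF _ assms(1) Suc assms(2)])
    fix T :: "'a set" assume "finite T"
    then show "real (card (perm_roots T r)) \<le> fact (card T)"
      using card_perm_roots_le_fact[of T r] by (metis of_nat_fact of_nat_le_iff)
  qed
  also have "\<dots> \<le> 2 * fact m" by simp
  also have "\<dots> \<le> 4 * fact (Suc m) / (real (Suc m) + 1)"
    by (simp add: field_simps)
  finally show ?thesis using Suc by simp
qed

text \<open>Second use of the recursion. The previous bound does not depend on \<open>r\<close>, and
  summed over all \<open>r \<le> n\<close> it only gives a multiple of \<open>fact n\<close>; the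
  present one has a term that is harmonic in \<open>r\<close>.\<close>

lemma card_perm_roots_bound_Suc:
  assumes "finite S" "card S = Suc m" "prime r" "r \<le> Suc m"
  shows "real (card (perm_roots S r)) \<le>
    fact m * (4 / real (Suc m) + 4 / real (Suc (Suc m - r)))"
  using card_perm_roots_step[OF card_perm_roots_bound[OF _ assms(3)] assms(1-3)] assms(4)
  by (simp add: field_simps)

section \<open>The family \<open>gS\<close> and the sum over prime orders\<close>

text \<open>The order \<open>r\<close> of a nonidentity member is prime, and a moved point lies on a
  cycle of exactly \<open>r\<close> points of \<open>{1..n}\<close>, whence
  \<open>r \<le> n\<close>.\<close>

lemma gS_subset:
  "gS n \<subseteq> insert id (\<Union>r\<in>{r. prime r \<and> r \<le> n}. perm_roots {1..n} r)"
proof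
  fix p assume p: "p \<in> gS n"
  then have pS: "p permutes {1..n}" by (simp add: gS_def sym_group_carrier)
  show "p \<in> insert id (\<Union>r\<in>{r. prime r \<and> r \<le> n}. perm_roots {1..n} r)"
  proof (cases "p = id")
    case False
    interpret G: group "sym_group n" by (rule sym_group_is_group)
    have fin: "finite (Sym n)" by (simp add: sym_group_def finite_permutations)
    define r where "r = G.ord p"
    have r: "prime r" unfolding r_def
      by (rule G.simple_cyclic_ord_prime[OF fin]) (use p False in \<open>auto simp: gS_def\<close>)
    have pr: "p ^^ r = id"
      using G.pow_ord_eq_1[of p] p unfolding r_def gS_def
      by (simp add: sym_group_pow sym_group_one)
    obtain x where x: "p x \<noteq> x" using False by (auto simp: fun_eq_iff)
    have perm: "permutation p" using pS permutation_permutes by blast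
    have "x \<in> {1..n}" using x permutes_not_in[OF pS] by blast
    have "r = length (support p x)" using least_power_root[OF pr r x] by simp
    also have "\<dots> = card (set (support p x))"
      by (rule distinct_card[symmetric, OF cycle_of_permutation[OF perm]])
    also have "\<dots> \<le> card {1..n}"
      by (rule card_mono[OF _ support_subset[OF pS \<open>x \<in> {1..n}\<close>]]) simp
    finally show ?thesis using r pr pS by (auto simp: perm_roots_def)
  qed simp
qed

text \<open>Any bound of order below \<open>n\<close> serves for the harmonic sum; the square root
  gives a telescoping estimate, by \<open>(b - a) * (b + a) = 1\<close> for consecutive
  roots.\<close>

lemma sum_inverse_le_sqrt: "(\<Sum>k<n. 1 / real (Suc k)) \<le> 2 * sqrt (real n)"
proof (induction n)
  case (Suc n)
  have "1 / real (Suc n) \<le> 2 * sqrt (real (Suc n)) - 2 * sqrt (real n)"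
  proof -
    define a b where "a = sqrt (real n)" and "b = sqrt (real (Suc n))"
    have b1: "b \<ge> 1" and ab: "a \<le> b" by (simp_all add: a_def b_def)
    have bb: "b * b = real (Suc n)" by (simp add: b_def)
    have sq: "(b - a) * (b + a) = 1" by (simp add: a_def b_def algebra_simps)
    have "1 / real (Suc n) = 1 / (b * b)" unfolding bb ..
    also have "\<dots> \<le> 1 / b" using b1 by (simp add: field_simps)
    also have "\<dots> = 2 * ((b - a) * (b + a)) / (2 * b)" unfolding sq by simp
    also have "\<dots> \<le> 2 * ((b - a) * (2 * b)) / (2 * b)"
      using ab b1 by (intro divide_right_mono mult_left_mono) auto
    also have "\<dots> = 2 * b - 2 * a" using b1 by (simp add: field_simps)
    also have "\<dots> = 2 * sqrt (real (Suc n)) - 2 * sqrt (real n)" by (simp add: a_def b_def)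
    finally show ?thesis .
  qed
  then show ?case using Suc by simp
qed simp

lemma card_gS_le:
  "real (card (gS (Suc m))) \<le> fact m * (5 + 8 * sqrt (real (Suc m)))"
proof -
  let ?P = "{r. prime r \<and> r \<le> Suc m}"
  have finP: "finite ?P" by (rule finite_subset[of _ "{..Suc m}"]) auto
  have sub: "?P \<subseteq> {1..Suc m}" by (auto simp: Suc_le_eq prime_gt_0_nat)
  have "card (gS (Suc m)) \<le> card (insert id (\<Union>r\<in>?P. perm_roots {1..Suc m} r))"
    by (rule card_mono[OF _ gS_subset]) (use finP in \<open>auto intro!: finite_perm_roots\<close>)
  also have "\<dots> \<le> Suc (card (\<Union>r\<in>?P. perm_roots {1..Suc m} r))"
    by (rule card_insert_le_m1) auto
  also have "\<dots> \<le> Suc (\<Sum>r\<in>?P. card (perm_roots {1..Suc m} r))"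
    using card_UN_le[OF finP] by simp
  finally have "real (card (gS (Suc m))) \<le> real (Suc (\<Sum>r\<in>?P. card (perm_roots {1..Suc m} r)))"
    by (simp only: of_nat_le_iff)
  also have "\<dots> = 1 + (\<Sum>r\<in>?P. real (card (perm_roots {1..Suc m} r)))" by simp
  also have "(\<Sum>r\<in>?P. real (card (perm_roots {1..Suc m} r))) \<le>
    (\<Sum>r\<in>?P. fact m * (4 / real (Suc m) + 4 / real (Suc (Suc m - r))))"
    by (intro sum_mono card_perm_roots_bound_Suc) auto
  \<comment> \<open>Primality of \<open>r\<close> is dropped here; no information on the density of
    primes enters.\<close>
  also have "\<dots> \<le> (\<Sum>r\<in>{1..Suc m}. fact m * (4 / real (Suc m) + 4 / real (Suc (Suc m - r))))"
    by (rule sum_mono2[OF _ sub]) auto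
  also have "\<dots> = fact m * (4 + 4 * (\<Sum>r\<in>{1..Suc m}. 1 / real (Suc (Suc m - r))))"
  proof -
    have "(\<Sum>r\<in>{1..Suc m}. 4 / real (Suc m)) = 4" by (simp add: field_simps)
    then show ?thesis
      by (simp only: sum_distrib_left[symmetric] sum.distrib) (simp add: sum_distrib_left)
  qed
  also have "(\<Sum>r\<in>{1..Suc m}. 1 / real (Suc (Suc m - r))) = (\<Sum>k<Suc m. 1 / real (Suc k))"
    by (rule sum.reindex_bij_witness[where i = "\<lambda>k. Suc m - k" and j = "\<lambda>k. Suc m - k"]) auto
  also have "\<dots> \<le> 2 * sqrt (real (Suc m))" by (rule sum_inverse_le_sqrt)
  finally have "real (card (gS (Suc m))) \<le> 1 + fact m * (4 + 4 * (2 * sqrt (real (Suc m))))"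
    by simp
  \<comment> \<open>The summand 1 for the identity is absorbed into \<open>fact m\<close>.\<close>
  also have "\<dots> \<le> fact m + fact m * (4 + 4 * (2 * sqrt (real (Suc m))))"
    by simp
  finally show ?thesis by (simp add: algebra_simps)
qed

subsection \<open>Normal words without repeated letters\<close>

text \<open>If a later block \<open>(k', j')\<close> had \<open>j' \<le> j\<close>, then
  \<open>j' \<le> j \<le> k < k'\<close>, and the letter \<open>k\<close> would occur in both
  blocks.\<close>

lemma distinct_D_product_word_sorted_snd:
  assumes "D_admissible n e" "distinct (D_product_word e)"
  shows "sorted_wrt (<) (map snd e)"
  using assms
proof (induction e)
  case (Cons a e)
  obtain k j where a: "a = (k, j)" by force
  have adm: "D_admissible n e" "1 \<le> j" "j \<le> k" and k: "\<And>k' j'. (k', j') \<in> set e \<Longrightarrow> k < k' \<and> j' \<le> k'"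
    using Cons.prems(1) by (auto simp: D_admissible_def a)
  have dis: "distinct (D_product_word e)" "set (D_word k j) \<inter> set (D_product_word e) = {}"
    using Cons.prems(2) by (auto simp: D_product_word_def a)
  have "j < j'" if "(k', j') \<in> set e" for k' j'
  proof (rule ccontr)
    assume "\<not> j < j'"
    then have "k \<in> set (D_word k' j')" "k \<in> set (D_word k j)"
      using k[OF that] adm by (auto simp: D_word_def)
    then show False using dis(2) that by (fastforce simp: D_product_word_def)
  qed
  then show ?case using Cons.IH[OF adm(1) dis(1)] by (auto simp: a)
qed simp

lemma sorted_list_of_set_eq:
  assumes "sorted_wrt (<) xs"
  shows "sorted_list_of_set (set xs) = (xs :: 'a::linorder list)"
  using assms by (simp add: strict_sorted_iff sorted_list_of_set.idem_if_sorted_distinct)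

text \<open>Both coordinate lists of the expression increase strictly, so sorting their sets and
  zipping restores it.\<close>

lemma card_bS_le: "card (bS n) \<le> 4 ^ n"
proof -
  let ?f = "\<lambda>(K, J). word_perm (D_product_word (zip (sorted_list_of_set K) (sorted_list_of_set J)))"
  let ?P = "Pow {1..n} \<times> Pow {1..n}"
  have "bS n \<subseteq> ?f ` ?P"
  proof
    fix p assume p: "p \<in> bS n"
    define e where "e = (THE e. D_admissible n e \<and> word_perm (D_product_word e) = p)"
    have "p \<in> Sym n" using p by (simp add: bS_def)
    from theI'[OF D_expression_unique[OF this]]
    have adm: "D_admissible n e" and wp: "word_perm (D_product_word e) = p"
      by (simp_all add: e_def)
    show "p \<in> ?f ` ?P"
    proof (cases "p = id")
      case True
      \<comment> \<open>Membership of the identity says nothing about its normal word, so it is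
        encoded directly by empty sets.\<close>
      have "?f ({}, {}) = p" unfolding True by (simp add: D_product_word_def fun_eq_iff)
      moreover have "({}, {}) \<in> ?P" by simp
      ultimately show ?thesis by (rule image_eqI[OF sym])
    next
      case False
      then have "distinct (D_product_word e)"
        using p by (simp add: bS_def normal_word_def e_def)
      then have "sorted_wrt (<) (map snd e)" by (rule distinct_D_product_word_sorted_snd[OF adm])
      moreover have "sorted_wrt (<) (map fst e)" using adm by (simp add: D_admissible_def)
      ultimately have "?f (set (map fst e), set (map snd e)) = p"
        using wp by (simp add: sorted_list_of_set_eq zip_map_fst_snd del: set_map)
      moreover have "(set (map fst e), set (map snd e)) \<in> ?P"
        using adm by (fastforce simp: D_admissible_def)
      ultimately show ?thesis by (rule image_eqI[OF sym])
    qed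
  qed
  then have "card (bS n) \<le> card (?f ` ?P)" by (intro card_mono) auto
  also have "\<dots> \<le> card ?P" by (rule card_image_le) simp
  also have "\<dots> = 4 ^ n"
    by (simp add: card_cartesian_product card_Pow power_mult_distrib[symmetric])
  finally show ?thesis .
qed

subsection \<open>Trees with vertex degrees at most two\<close>

text \<open>The shape forced on the subtrees of the root: their vertices already have an edge to a
  parent, so degree at most 2 leaves room for one child.\<close>

fun path_tree :: "'a tree \<Rightarrow> bool" where
  "path_tree Leaf \<longleftrightarrow> True"
| "path_tree (Node l s r) \<longleftrightarrow> (l = Leaf \<or> r = Leaf) \<and> path_tree l \<and> path_tree r"

lemma tree_edges_subset: "e \<in> tree_edges t \<Longrightarrow> e \<subseteq> set_tree t"
proof (induction t)
  case (Node l s r)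
  then show ?case by (cases l; cases r) auto
qed simp

lemma finite_tree_edges: "finite (tree_edges t)"
proof (induction t)
  case (Node l s r)
  have "finite (root_labels l \<union> root_labels r)" by (cases l; cases r) auto
  then show ?case using Node by simp
qed simp

lemma finite_edges_at: "finite {e \<in> tree_edges t. v \<in> e}"
  by (simp add: finite_tree_edges)

lemma tree_degree_mono:
  assumes "tree_edges t \<subseteq> tree_edges u"
  shows "tree_degree t v \<le> tree_degree u v"
  unfolding tree_degree_def using assms
  by (intro card_mono) (auto simp: finite_tree_edges)

text \<open>The edge from \<open>v\<close> to its new parent \<open>s\<close> is not an edge of
  \<open>u\<close>, since \<open>s\<close> is not a label there.\<close>

lemma tree_degree_child:
  assumes "u = l \<or> u = r" "s \<notin> set_tree u" "v \<in> root_labels u"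
  shows "Suc (tree_degree u v) \<le> tree_degree (Node l s r) v"
proof -
  have "{s, v} \<notin> tree_edges u" using assms(2) tree_edges_subset by blast
  then have "Suc (tree_degree u v) = card (insert {s, v} {e \<in> tree_edges u. v \<in> e})"
    unfolding tree_degree_def by (simp add: finite_tree_edges)
  also have "\<dots> \<le> tree_degree (Node l s r) v"
    unfolding tree_degree_def using assms(1,3)
    by (intro card_mono finite_edges_at) auto
  finally show ?thesis .
qed

lemma subtree_degree_ge_3:
  assumes "u = l \<or> u = r" "s \<notin> set_tree u"
    and "\<exists>v\<in>set_tree u. tree_degree u v \<ge> 3 \<or> (v \<in> root_labels u \<and> tree_degree u v \<ge> 2)"
  shows "\<exists>v\<in>set_tree (Node l s r). tree_degree (Node l s r) v \<ge> 3"
proof -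
  obtain v where v: "v \<in> set_tree u"
    "tree_degree u v \<ge> 3 \<or> (v \<in> root_labels u \<and> tree_degree u v \<ge> 2)"
    using assms(3) by blast
  have "tree_edges u \<subseteq> tree_edges (Node l s r)" using assms(1) by auto
  then have "tree_degree u v \<le> tree_degree (Node l s r) v" by (rule tree_degree_mono)
  moreover have "v \<in> set_tree (Node l s r)" using v(1) assms(1) by auto
  ultimately show ?thesis
    using v(2) tree_degree_child[OF assms(1,2), of v]
    by (intro bexI[of _ v]) linarith+
qed

text \<open>A branching vertex has two child edges, and a third edge unless it is the root. The
  clause for the root carries the induction: that vertex gains its third edge when the tree is hung
  below another vertex.\<close>

lemma not_path_tree_degree:
  assumes "distinct (inorder t)" "\<not> path_tree t"
  shows "\<exists>v\<in>set_tree t. tree_degree t v \<ge> 3 \<or> (v \<in> root_labels t \<and> tree_degree t v \<ge> 2)"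
  using assms
proof (induction t)
  case (Node l s r)
  have dl: "distinct (inorder l)" "s \<notin> set_tree l" and dr: "distinct (inorder r)" "s \<notin> set_tree r"
    and lr: "set_tree l \<inter> set_tree r = {}"
    using Node.prems(1) by auto
  show ?case
  proof (cases "path_tree l \<and> path_tree r")
    case True
    then have "l \<noteq> Leaf" "r \<noteq> Leaf" using Node.prems(2) by auto
    then obtain a l1 l2 b r1 r2 where l: "l = Node l1 a l2" and r: "r = Node r1 b r2"
      by (metis neq_Leaf_iff)
    \<comment> \<open>Edges are sets of labels, so the two child edges differ only because the
      labels do.\<close>
    have "{s, a} \<noteq> {s, b}" using lr dl(2) dr(2) l r by (auto simp: doubleton_eq_iff)
    then have "2 = card {{s, a}, {s, b}}" by simp
    also have "\<dots> \<le> tree_degree (Node l s r) s"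
      unfolding tree_degree_def using l r
      by (intro card_mono finite_edges_at) auto
    finally show ?thesis by auto
  next
    case False
    then show ?thesis
      using subtree_degree_ge_3[of l l r s] subtree_degree_ge_3[of r l r s] Node.IH dl dr by blast
  qed
qed simp

lemma small_degree_path_subtrees:
  assumes "distinct (inorder (Node l s r))"
    and "\<forall>v\<in>set_tree (Node l s r). tree_degree (Node l s r) v \<le> 2"
  shows "path_tree l \<and> path_tree r"
proof (rule ccontr)
  assume "\<not> (path_tree l \<and> path_tree r)"
  then have "\<exists>v\<in>set_tree (Node l s r). tree_degree (Node l s r) v \<ge> 3"
    using subtree_degree_ge_3[of l l r s] subtree_degree_ge_3[of r l r s]
      not_path_tree_degree[of l] not_path_tree_degree[of r] assms(1) by auto
  then show False using assms(2) by fastforce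
qed

section \<open>From trees back to words\<close>

lemma word_split_at_Min:
  assumes "w \<noteq> []"
  shows "takeWhile (\<lambda>x. x \<noteq> Min (set w)) w @ Min (set w) # tl (dropWhile (\<lambda>x. x \<noteq> Min (set w)) w) = w"
proof -
  have "dropWhile (\<lambda>x. x \<noteq> Min (set w)) w \<noteq> []" by (rule dropWhile_Min_nonempty[OF assms])
  then have "dropWhile (\<lambda>x. x \<noteq> Min (set w)) w =
      Min (set w) # tl (dropWhile (\<lambda>x. x \<noteq> Min (set w)) w)"
    using hd_dropWhile[of "\<lambda>x. x \<noteq> Min (set w)" w] by (metis (no_types, lifting) list.collapse)
  then show ?thesis by (metis takeWhile_dropWhile_id)
qed

lemma inorder_dec_tree: "inorder (dec_tree w) = w"
proof (induction w rule: dec_tree.induct)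
  case (2 w)
  then show ?case using word_split_at_Min[OF 2(1)] by (simp add: Let_def)
qed simp

lemma dec_tree_eq_Leaf: "dec_tree w = Leaf \<longleftrightarrow> w = []"
  by (metis dec_tree.simps(1) inorder.simps(1) inorder_dec_tree)

text \<open>In a path the minimum has an empty side at every level, so it stands at an end of the
  word. At the left end it extends \<open>xs\<close>, at the right end \<open>ys\<close>.\<close>

lemma path_dec_tree_unimodal:
  assumes "path_tree (dec_tree w)" "distinct w"
  shows "\<exists>xs ys. w = xs @ rev ys \<and> sorted_wrt (<) xs \<and> sorted_wrt (<) ys"
  using assms
proof (induction w rule: dec_tree.induct)
  case 1
  then show ?case by (intro exI[of _ "[]"]) simp
next
  case (2 w)
  define s where "s = Min (set w)"
  define u v where "u = takeWhile (\<lambda>x. x \<noteq> s) w" and "v = tl (dropWhile (\<lambda>x. x \<noteq> s) w)"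
  have w: "w = u @ s # v" using word_split_at_Min[OF 2(1)] by (simp add: s_def u_def v_def)
  have tree: "dec_tree w = Node (dec_tree u) s (dec_tree v)"
    using 2(1) by (simp add: Let_def s_def u_def v_def)
  have less: "s < x" if "x \<in> set u \<union> set v" for x
  proof -
    have "s \<le> x" unfolding s_def using that w by (intro Min_le) auto
    moreover have "x \<noteq> s" using \<open>distinct w\<close> that w by auto
    ultimately show ?thesis by simp
  qed
  have IHu: "\<exists>xs ys. u = xs @ rev ys \<and> sorted_wrt (<) xs \<and> sorted_wrt (<) ys"
    by (rule 2(2)[OF s_def, folded u_def]) (use 2(4,5) tree w in auto)
  have IHv: "\<exists>xs ys. v = xs @ rev ys \<and> sorted_wrt (<) xs \<and> sorted_wrt (<) ys"
    by (rule 2(3)[OF s_def, folded v_def]) (use 2(4,5) tree w in auto)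
  have "u = [] \<or> v = []" using 2(4) tree dec_tree_eq_Leaf by simp
  then show ?case
  proof
    assume "u = []"
    obtain xs ys where "v = xs @ rev ys" "sorted_wrt (<) xs" "sorted_wrt (<) ys" using IHv by blast
    then show ?thesis using less w \<open>u = []\<close> by (intro exI[of _ "s # xs"] exI[of _ ys]) auto
  next
    assume "v = []"
    obtain xs ys where "u = xs @ rev ys" "sorted_wrt (<) xs" "sorted_wrt (<) ys" using IHu by blast
    then show ?thesis using less w \<open>v = []\<close> by (intro exI[of _ xs] exI[of _ "s # ys"]) auto
  qed
qed

text \<open>Two unimodal words side by side, each monotone run being encoded by its set of
  letters.\<close>

definition zigzag_word :: "'a::linorder set \<times> 'a set \<times> 'a set \<times> 'a set \<Rightarrow> 'a list" where
  "zigzag_word = (\<lambda>(A, B, C, D). sorted_list_of_set A @ rev (sorted_list_of_set B) @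
     sorted_list_of_set C @ rev (sorted_list_of_set D))"

lemma small_degree_zigzag_word:
  assumes "distinct w"
    and "size (dec_tree w) = 1 \<or> (\<forall>v\<in>set_tree (dec_tree w). tree_degree (dec_tree w) v \<in> {1, 2})"
  shows "w \<in> zigzag_word ` (Pow (set w) \<times> Pow (set w) \<times> Pow (set w) \<times> Pow (set w))"
\<comment> \<open>The empty word satisfies the degree condition vacuously.\<close>
proof (cases "w = []")
  case True
  then show ?thesis by (simp add: zigzag_word_def)
next
  case False
  define s where "s = Min (set w)"
  define u v where "u = takeWhile (\<lambda>x. x \<noteq> s) w" and "v = tl (dropWhile (\<lambda>x. x \<noteq> s) w)"
  have w: "w = u @ s # v" using word_split_at_Min[OF False] by (simp add: s_def u_def v_def)
  have tree: "dec_tree w = Node (dec_tree u) s (dec_tree v)"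
    using False by (simp add: Let_def s_def u_def v_def)
  have "path_tree (dec_tree u) \<and> path_tree (dec_tree v)"
    using assms(2)
  proof
    assume "size (dec_tree w) = 1"
    then show ?thesis by (simp add: tree)
  next
    assume "\<forall>v\<in>set_tree (dec_tree w). tree_degree (dec_tree w) v \<in> {1, 2}"
    then show ?thesis
      using assms(1) inorder_dec_tree[of w] unfolding tree
      by (intro small_degree_path_subtrees) fastforce+
  qed
  moreover have "distinct u" "distinct v" using assms(1) w by simp_all
  ultimately obtain a b c d where u: "u = a @ rev b" and v: "v = c @ rev d"
    and sorted: "sorted_wrt (<) a" "sorted_wrt (<) b" "sorted_wrt (<) c" "sorted_wrt (<) d"
    using path_dec_tree_unimodal by metis
  have "s < x" if "x \<in> set c" for x
  proof -
    have "s \<le> x" unfolding s_def using that w v by (intro Min_le) auto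
    moreover have "x \<noteq> s" using \<open>distinct w\<close> that w v by auto
    ultimately show ?thesis by simp
  qed
  \<comment> \<open>The root is smaller than every letter of \<open>c\<close>, so it joins the third
    run and four sets suffice.\<close>
  then have "sorted_wrt (<) (s # c)" using sorted(3) by simp
  then have "w = zigzag_word (set a, set b, set (s # c), set d)"
    unfolding zigzag_word_def using sorted by (simp add: sorted_list_of_set_eq w u v del: list.set)
  then show ?thesis by (rule image_eqI) (auto simp: w u v)
qed

subsection \<open>The word of the cycle decomposition\<close>

text \<open>The blocks are recovered from the concatenation because their heads are its records.\<close>

lemma concat_records_inject:
  assumes "concat xss = concat yss"
    and "\<And>xs. xs \<in> set xss \<Longrightarrow> xs \<noteq> [] \<and> (\<forall>x\<in>set xs. x \<le> hd xs)"
    and "\<And>ys. ys \<in> set yss \<Longrightarrow> ys \<noteq> [] \<and> (\<forall>y\<in>set ys. y \<le> hd ys)"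
    and "sorted_wrt (<) (map hd xss)" "sorted_wrt (<) (map hd yss)"
  shows "xss = (yss :: 'a::linorder list list)"
  using assms
proof (induction xss arbitrary: yss)
  case Nil
  then show ?case by (cases yss) auto
next
  case (Cons xs xss)
  \<comment> \<open>A block is the longest prefix bounded by its head, since the next block opens
    with a larger letter.\<close>
  have block: "takeWhile (\<lambda>x. x \<le> hd zs) (concat (zs # zss)) = zs"
    if "\<And>ys. ys \<in> set (zs # zss) \<Longrightarrow> ys \<noteq> [] \<and> (\<forall>y\<in>set ys. y \<le> hd ys)"
      "sorted_wrt (<) (map hd (zs # zss))" for zs :: "'a list" and zss
  proof (cases zss)
    case Nil
    then show ?thesis using that(1) by (simp add: takeWhile_eq_all_conv)
  next
    case (Cons us uss)
    then have "hd zs < hd us" "us \<noteq> []" using that by auto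
    then have "takeWhile (\<lambda>x. x \<le> hd zs) (concat zss) = []"
      using Cons by (cases us) auto
    then show ?thesis using that(1)[of zs] by simp
  qed
  obtain ys zss where yss: "yss = ys # zss"
    using Cons.prems(1) Cons.prems(2)[of xs] by (cases yss) auto
  have "hd (concat (xs # xss)) = hd xs" "hd (concat (ys # zss)) = hd ys"
    using Cons.prems(2)[of xs] Cons.prems(3)[of ys] yss by auto
  then have hd: "hd xs = hd ys" using Cons.prems(1) yss by simp
  have "takeWhile (\<lambda>x. x \<le> hd xs) (concat (xs # xss)) = xs"
    by (rule block) (use Cons.prems in auto)
  moreover have "takeWhile (\<lambda>x. x \<le> hd ys) (concat (ys # zss)) = ys"
    by (rule block) (use Cons.prems yss in auto)
  ultimately have "xs = ys" using Cons.prems(1) hd yss by metis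
  moreover have "xss = zss"
    by (rule Cons.IH) (use Cons.prems yss \<open>xs = ys\<close> in auto)
  ultimately show ?case using yss by simp
qed

lemma hd_support: "permutation p \<Longrightarrow> hd (support p x) = x"
  by (metis list.sel(1) support_eq_Cons)

lemma map_hd_cycles:
  assumes "permutation p"
  shows "map hd (cycles n p) = filter (\<lambda>m. \<forall>x\<in>set (support p m). x \<le> m) [1..<Suc n]"
  unfolding cycles_def map_map comp_def hd_support[OF assms] by simp

lemma sorted_hd_cycles:
  assumes "permutation p"
  shows "sorted_wrt (<) (map hd (cycles n p))"
  unfolding map_hd_cycles[OF assms] by (intro sorted_wrt_filter sorted_wrt_upt)

text \<open>Injectivity of Foata's fundamental transformation: the word determines its blocks, and
  the block containing a point determines the image of that point.\<close>

lemma inj_on_concat_cycles: "inj_on (\<lambda>p. concat (cycles n p)) (Sym n)"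
proof (rule inj_onI)
  fix p q assume pq: "p \<in> Sym n" "q \<in> Sym n" "concat (cycles n p) = concat (cycles n q)"
  have pS: "p permutes {1..n}" and qS: "q permutes {1..n}"
    using pq by (simp_all add: sym_group_carrier)
  have perm: "permutation p" "permutation q" using pq sym_group_carrier' by blast+
  have block: "xs \<noteq> [] \<and> (\<forall>x\<in>set xs. x \<le> hd xs)" if xs: "xs \<in> set (cycles n f)" and f: "permutation f" for xs f
  proof -
    obtain m where m: "xs = support f m" "\<forall>x\<in>set xs. x \<le> m" using xs unfolding set_cycles by auto
    moreover have "xs \<noteq> []" using mem_support[OF f, of m] m(1) by (metis empty_iff empty_set)
    ultimately show ?thesis using hd_support[OF f, of m] by metis
  qed
  have eq: "cycles n p = cycles n q"
    by (rule concat_records_inject[OF pq(3)]) (use block perm sorted_hd_cycles in blast)+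
  show "p = q"
  proof
    fix x
    show "p x = q x"
    proof (cases "x \<in> {1..n}")
      case True
      obtain m where m: "x \<in> set (support p m)" "support p m \<in> set (cycles n p)"
        by (rule cycle_max_exists[OF pS True])
      then obtain m' where m': "support p m = support q m'" unfolding eq set_cycles by auto
      then show ?thesis
        using cycle_restrict[OF perm(1) m(1)] cycle_restrict[OF perm(2), of x m'] m(1) by metis
    next
      case False
      then show ?thesis using permutes_not_in[OF pS] permutes_not_in[OF qS] by metis
    qed
  qed
qed

lemma set_concat_cycles_subset:
  assumes "p permutes {1..n}"
  shows "set (concat (cycles n p)) \<subseteq> {1..n}"
proof
  fix x assume "x \<in> set (concat (cycles n p))"
  then obtain m where "m \<in> {1..n}" "x \<in> set (support p m)" unfolding set_concat set_cycles by blast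
  then show "x \<in> {1..n}" using support_subset[OF assms] by blast
qed

text \<open>Two listed cycles with a common point have the same set, hence the same maximum, and so
  are the same list.\<close>

lemma distinct_concat_cycles:
  assumes "permutation p"
  shows "distinct (concat (cycles n p))"
proof (rule distinct_concat)
  have "distinct (map hd (cycles n p))"
    unfolding map_hd_cycles[OF assms] by (intro distinct_filter distinct_upt)
  then show "distinct (cycles n p)" by (simp only: distinct_map)
next
  fix ys assume "ys \<in> set (cycles n p)"
  then obtain m where "ys = support p m" unfolding set_cycles by blast
  then show "distinct ys" by (metis cycle_of_permutation[OF assms])
next
  fix ys zs assume yz: "ys \<in> set (cycles n p)" "zs \<in> set (cycles n p)" "ys \<noteq> zs"
  obtain m where m: "ys = support p m" "\<forall>x\<in>set ys. x \<le> m" using yz(1) unfolding set_cycles by auto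
  obtain k where k: "zs = support p k" "\<forall>x\<in>set zs. x \<le> k" using yz(2) unfolding set_cycles by auto
  show "set ys \<inter> set zs = {}"
  proof (rule ccontr)
    assume "set ys \<inter> set zs \<noteq> {}"
    then have "m \<in> set zs" using disjoint_support'[OF assms, of m k] m(1) k(1) by metis
    then have "set ys = set zs" using support_eq_if_mem[OF assms, of m k] m(1) k(1) by metis
    then have "k \<in> set ys" using mem_support[OF assms, of k] k(1) by metis
    then have "m = k" using \<open>m \<in> set zs\<close> m(2) k(2) by (meson order_antisym)
    then show False using yz(3) m(1) k(1) by simp
  qed
qed

lemma card_tS_le: "card (tS n) \<le> 16 ^ n"
proof -
  let ?w = "\<lambda>p. concat (cycles n p)"
  let ?P = "Pow {1..n} \<times> Pow {1..n} \<times> Pow {1..n} \<times> Pow {1..n}"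
  have inj: "inj_on ?w (tS n)"
    by (rule inj_on_subset[OF inj_on_concat_cycles]) (auto simp: tS_def)
  have sub: "?w ` tS n \<subseteq> zigzag_word ` ?P"
  proof (rule image_subsetI)
    fix p assume p: "p \<in> tS n"
    then have pS: "p permutes {1..n}" by (simp add: tS_def sym_group_carrier)
    then have "permutation p" using permutation_permutes by blast
    then have "?w p \<in> zigzag_word ` (Pow (set (?w p)) \<times> Pow (set (?w p)) \<times> Pow (set (?w p)) \<times> Pow (set (?w p)))"
      using p by (intro small_degree_zigzag_word distinct_concat_cycles) (auto simp: tS_def Let_def)
    also have "\<dots> \<subseteq> zigzag_word ` ?P"
      by (intro image_mono Sigma_mono Pow_mono set_concat_cycles_subset[OF pS])
    finally show "?w p \<in> zigzag_word ` ?P" .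
  qed
  have "card (tS n) \<le> card (zigzag_word ` ?P)" by (rule card_inj_on_le[OF inj sub]) simp
  also have "\<dots> \<le> card ?P" by (rule card_image_le) simp
  also have "\<dots> = 16 ^ n"
    by (simp add: card_cartesian_product card_Pow power_mult_distrib[symmetric])
  finally show ?thesis .
qed

subsection \<open>Limits\<close>

lemma power_over_fact_tendsto_0: "(\<lambda>n. x ^ n / fact n) \<longlonglongrightarrow> (0::real)"
  using summable_LIMSEQ_zero[OF summable_exp[of x]] by (simp add: field_simps)

text \<open>The bound is required only for \<open>n \<ge> 1\<close> because the estimates for
  \<open>cS\<close> and \<open>gS\<close> divide by \<open>n\<close>.\<close>

lemma ratio_tendsto_0:
  fixes f :: "nat \<Rightarrow> nat"
  assumes "\<And>n. n \<ge> 1 \<Longrightarrow> real (f n) / fact n \<le> g n" "g \<longlonglongrightarrow> 0"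
  shows "(\<lambda>n. real (f n) / fact n) \<longlonglongrightarrow> 0"
  by (rule tendsto_sandwich[OF _ _ tendsto_const assms(2)])
    (auto intro: assms(1) eventually_sequentiallyI[of 1])

theorem theorem1p9:
  shows "\<forall>A \<in> {cS, gS, bS, tS}.
    rare A \<and> (\<lambda>n. real (card (A n)) / fact n) \<longlonglongrightarrow> 0"
proof -
  have fact_eq: "fact n = real n * fact (n - 1)" if "n \<ge> 1" for n
    using that by (cases n) simp_all
  have c: "(\<lambda>n. real (card (cS n)) / fact n) \<longlonglongrightarrow> 0"
  proof (rule ratio_tendsto_0)
    show "real (card (cS n)) / fact n \<le> 4 / real n" if "n \<ge> 1" for n
      using card_cS_le[OF that] that unfolding fact_eq[OF that] by (simp add: field_simps)
    show "(\<lambda>n. 4 / real n) \<longlonglongrightarrow> 0"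
      by (rule lim_const_over_n)
  qed
  have g: "(\<lambda>n. real (card (gS n)) / fact n) \<longlonglongrightarrow> 0"
  proof (rule ratio_tendsto_0)
    show "real (card (gS n)) / fact n \<le> 5 / real n + 8 * inverse (sqrt (real n))" if n: "n \<ge> 1" for n
    proof -
      obtain m where m: "n = Suc m" using n by (cases n) auto
      have "real (card (gS n)) / fact n \<le> fact m * (5 + 8 * sqrt (real n)) / (real n * fact m)"
        unfolding fact_eq[OF n] using card_gS_le[of m]
        by (intro frac_le) (simp_all add: m add_pos_nonneg)
      also have "\<dots> = 5 / real n + 8 * (sqrt (real n) / real n)"
        using n by (simp add: field_simps)
      also have "sqrt (real n) / real n = inverse (sqrt (real n))"
        by (simp add: sqrt_divide_self_eq)
      finally show ?thesis .
    qed
    have "(\<lambda>n. inverse (sqrt (real n))) \<longlonglongrightarrow> 0"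
      by (intro tendsto_inverse_0_at_top filterlim_compose[OF sqrt_at_top] filterlim_real_sequentially)
    then show "(\<lambda>n. 5 / real n + 8 * inverse (sqrt (real n))) \<longlonglongrightarrow> 0"
      by (intro tendsto_add_zero tendsto_mult_right_zero lim_const_over_n)
  qed
  have b: "(\<lambda>n. real (card (bS n)) / fact n) \<longlonglongrightarrow> 0"
  proof (rule ratio_tendsto_0)
    show "real (card (bS n)) / fact n \<le> 4 ^ n / fact n" for n
      using of_nat_mono[OF card_bS_le[of n], where 'a = real] by (simp add: divide_right_mono)
  qed (rule power_over_fact_tendsto_0)
  have t: "(\<lambda>n. real (card (tS n)) / fact n) \<longlonglongrightarrow> 0"
  proof (rule ratio_tendsto_0)
    show "real (card (tS n)) / fact n \<le> 16 ^ n / fact n" for n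
      using of_nat_mono[OF card_tS_le[of n], where 'a = real] by (simp add: divide_right_mono)
  qed (rule power_over_fact_tendsto_0)
  have card_Sym: "card (Sym n) = fact n" for n
    using card_permutations[of "{1..n}" n] by (simp add: sym_group_def)
  have "cS n \<subseteq> Sym n" "gS n \<subseteq> Sym n" "bS n \<subseteq> Sym n" "tS n \<subseteq> Sym n" for n
    by (auto simp: cS_def gS_def bS_def tS_def)
  then show ?thesis using c g b t by (simp add: rare_def card_Sym)
qed

end
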